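(* Let $H\in(0,1/2)$, $a\in\mathbb{R}$, $\sigma>0$ and $Y_0>0$ be fixed, and let $\{B^H_t,t\ge0\}$ be a fractional Brownian motion with Hurst index $H$. For each $k>0$ let $Y^{(k)}=\{Y^{(k)}_t,t\ge0\}$ be the process driven by this same $B^H$, started from the same level $Y_0$, satisfying $$Y^{(k)}_t=\begin{cases}Y_0+\frac12\int_0^t\left(\frac{k}{Y^{(k)}_s}-aY^{(k)}_s\right)ds+\frac{\sigma}{2}B_t^H, & t<\tau^{(k)},\\ 0,& t\ge\tau^{(k)},\end{cases}\qquad \tau^{(k)}:=\inf\{t\ge0: Y^{(k)}_t=0\}.$$ Then for all $T>0$, $$\mathbb{P}\left(\tau^{(k)}>T\right)\to1,\qquad k\to\infty.$$
   Context: A fractional Brownian motion with Hurst index $H\in(0,1)$ is a centered Gaussian process $\{B^H_t,t\ge0\}$ with $B^H_0=0$, covariance $\mathbb{E}B^H_tB^H_s=\frac12(t^{2H}+s^{2H}-|t-s|^{2H})$, and continuous paths. The processes $Y^{(k)}$ satisfy their equation pathwise, have continuous paths, are strictly positive on $[0,\tau^{(k)})$, and $\inf\emptyset=\infty$. *)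

theory Defs
  imports "HOL-Probability.Probability"
begin

(* Point masses count as Gaussian; for instance B 0 = 0 below. *)
definition gaussian_rv :: "'a measure \<Rightarrow> ('a \<Rightarrow> real) \<Rightarrow> bool" where
  "gaussian_rv M X \<longleftrightarrow> X \<in> borel_measurable M \<and>
     ((\<exists>m. AE w in M. X w = m) \<or>
      (\<exists>m s. s > 0 \<and> distributed M lborel X (normal_density m s)))"

definition gaussian_process :: "'a measure \<Rightarrow> (real \<Rightarrow> 'a \<Rightarrow> real) \<Rightarrow> bool" where
  "gaussian_process M X \<longleftrightarrow>
     (\<forall>J c. finite J \<longrightarrow> J \<subseteq> {0..} \<longrightarrow> gaussian_rv M (\<lambda>w. \<Sum>t\<in>J. c t * X t w))"

(* Processes are indexed by real numbers, but only their values at t >= 0 are constrained.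
   Path properties hold for every w in the sample space. *)
definition fractional_brownian_motion ::
    "'a measure \<Rightarrow> real \<Rightarrow> (real \<Rightarrow> 'a \<Rightarrow> real) \<Rightarrow> bool" where
  "fractional_brownian_motion M H B \<longleftrightarrow>
     0 < H \<and> H < 1 \<and>
     gaussian_process M B \<and>
     (\<forall>t\<ge>0. (\<integral>w. B t w \<partial>M) = 0) \<and>
     (\<forall>t\<ge>0. \<forall>s\<ge>0. (\<integral>w. B t w * B s w \<partial>M) =
        (t powr (2 * H) + s powr (2 * H) - \<bar>t - s\<bar> powr (2 * H)) / 2) \<and>
     (\<forall>w\<in>space M. B 0 w = 0 \<and> continuous_on {0..} (\<lambda>t. B t w))"

(* Extended real valued, so that the infimum of the empty set is infinity. *)
definition first_zero :: "(real \<Rightarrow> real) \<Rightarrow> ereal" where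
  "first_zero y = Inf (ereal ` {t. t \<ge> 0 \<and> y t = 0})"

(* Before the first zero the integrand is continuous on the compact interval {0..t},
   so the integral there always exists. *)
definition solution_path ::
    "real \<Rightarrow> real \<Rightarrow> real \<Rightarrow> real \<Rightarrow> (real \<Rightarrow> real) \<Rightarrow> (real \<Rightarrow> real) \<Rightarrow> bool" where
  "solution_path a \<sigma> y0 k b y \<longleftrightarrow>
     continuous_on {0..} y \<and>
     (\<forall>t\<ge>0. ereal t < first_zero y \<longrightarrow>
        0 < y t \<and>
        y t = y0 + 1 / 2 * integral {0..t} (\<lambda>s. k / y s - a * y s) + \<sigma> / 2 * b t) \<and>
     (\<forall>t\<ge>0. first_zero y \<le> ereal t \<longrightarrow> y t = 0)"

(* The initial condition is not implied by solution_path, which the zero path satisfies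
   vacuously. *)
definition solution_process ::
    "'a measure \<Rightarrow> real \<Rightarrow> real \<Rightarrow> real \<Rightarrow> real \<Rightarrow>
     (real \<Rightarrow> 'a \<Rightarrow> real) \<Rightarrow> (real \<Rightarrow> 'a \<Rightarrow> real) \<Rightarrow> bool" where
  "solution_process M a \<sigma> y0 k B Y \<longleftrightarrow>
     (\<forall>t\<ge>0. Y t \<in> borel_measurable M) \<and>
     (\<forall>w\<in>space M. Y 0 w = y0 \<and> solution_path a \<sigma> y0 k (\<lambda>t. B t w) (\<lambda>t. Y t w))"

end

theory Submission
  imports Defs
begin

text \<open>
  The statement holds path by path: on every single trajectory of the noise there is a
  threshold \<open>K\<close> such that no solution with \<open>k \<ge> K\<close> vanishes up to time \<open>T\<close>. The reason is the
  continuity of the trajectory. To reach \<open>0\<close> at some time \<open>r \<le> T\<close>, the solution has to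
  fall from its initial level \<open>y0\<close>; let \<open>s\<close> be its last visit to that level. On \<open>[s, r)\<close> the
  solution lies in \<open>(0, y0]\<close>, so its drift is at least \<open>(k / y0 - \<bar>a\<bar> y0) / 2\<close>, which is as large
  as desired. The noise must therefore cause the loss of \<open>y0\<close> and also offset the upward push
  of the drift. If \<open>r - s\<close> is small, uniform continuity of the noise on \<open>[0, T]\<close> prevents it from
  losing \<open>y0\<close>; if \<open>r - s\<close> is not small, the push of the drift exceeds the oscillation of the
  noise once \<open>k\<close> is large (\<open>positive_for_large_k\<close>).

  Since a solution stays at \<open>0\<close> after its first zero, the event \<open>\<tau> > T\<close> is just
  \<open>Y T > 0\<close> (\<open>first_zero_gt_iff\<close>). Hence it is measurable, its indicator converges to \<open>1\<close>
  pointwise by the above, and dominated convergence gives convergence of the probabilities.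
\<close>

lemma first_zero_gt_iff:
  assumes "solution_path a \<sigma> y0 k b y" "t \<ge> 0"
  shows "ereal t < first_zero y \<longleftrightarrow> 0 < y t"
  using assms unfolding solution_path_def by (metis less_irrefl not_less)

lemma first_zero_eqI:
  assumes "r \<ge> 0" "y r = 0" and "\<And>t. 0 \<le> t \<Longrightarrow> y t = 0 \<Longrightarrow> r \<le> t"
  shows "first_zero y = ereal r"
  unfolding first_zero_def using assms by (intro Inf_eqI) auto

text \<open>
  Subtracting the integral equation at two times before the first zero turns a lower bound on
  the drift into a lower bound on the increment of the solution.
\<close>

lemma solution_path_increment_ge:
  assumes sol: "solution_path a \<sigma> y0 k b y"
    and st: "0 \<le> s" "s \<le> t" "ereal t < first_zero y"
    and drift: "\<And>u. s \<le> u \<Longrightarrow> u \<le> t \<Longrightarrow> C \<le> k / y u - a * y u"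
  shows "y s + C / 2 * (t - s) + \<sigma> / 2 * (b t - b s) \<le> y t"
proof -
  let ?f = "\<lambda>u. k / y u - a * y u"
  have before: "ereal u < first_zero y" if "u \<le> t" for u
    using that st(3) by (meson ereal_less_eq(3) le_less_trans)
  have eq: "0 < y u \<and> y u = y0 + 1 / 2 * integral {0..u} ?f + \<sigma> / 2 * b u"
    if "0 \<le> u" "u \<le> t" for u
    using sol that before unfolding solution_path_def by blast
  have "continuous_on {0..t} y"
    using sol unfolding solution_path_def by (auto intro: continuous_on_subset)
  moreover have "\<forall>u\<in>{0..t}. y u \<noteq> 0"
    using eq by fastforce
  ultimately have "continuous_on {0..t} ?f"
    by (intro continuous_intros) auto
  then have int: "?f integrable_on {0..t}" and int': "?f integrable_on {s..t}"
    using st(1) by (auto intro!: integrable_continuous_real intro: continuous_on_subset)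
  have "C * (t - s) = integral {s..t} (\<lambda>_. C)"
    using st by simp
  also have "\<dots> \<le> integral {s..t} ?f"
    using int' drift by (intro integral_le) auto
  finally have "C * (t - s) \<le> integral {0..t} ?f - integral {0..s} ?f"
    using Henstock_Kurzweil_Integration.integral_combine[OF st(1,2) int] by simp
  then show ?thesis
    using eq[of s] eq[of t] st by (simp add: field_simps)
qed

text \<open>
  The last visit \<open>s\<close> to the initial level before the first zero \<open>r\<close>; by the intermediate value
  theorem the path stays at or below this level on the whole of \<open>[s, r]\<close>.
\<close>

lemma last_visit_before_zero:
  fixes y :: "real \<Rightarrow> real"
  assumes cont: "continuous_on {0..} y" and y0: "y 0 = y0" "y0 > 0" and T: "T \<ge> 0" "y T = 0"
  obtains s r where "0 \<le> s" "s < r" "r \<le> T" "first_zero y = ereal r" "y s = y0" "y r = 0"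
    "\<And>u. s \<le> u \<Longrightarrow> u \<le> r \<Longrightarrow> y u \<le> y0"
proof -
  have level: "compact {t \<in> {0..c}. y t = l}" for c l
  proof -
    have "closed {t \<in> {0..c}. y t = l}"
      by (rule continuous_closed_preimage_constant)
        (auto intro: continuous_on_subset[OF cont])
    moreover have "{t \<in> {0..c}. y t = l} = {0..c} \<inter> {t \<in> {0..c}. y t = l}"
      by auto
    ultimately show ?thesis
      by (metis compact_Icc compact_Int_closed)
  qed
  obtain r where r: "0 \<le> r" "r \<le> T" "y r = 0"
    and r_min: "\<And>t. 0 \<le> t \<Longrightarrow> t \<le> T \<Longrightarrow> y t = 0 \<Longrightarrow> r \<le> t"
    using compact_attains_inf[OF level[of T 0]] T by auto
  obtain s where s: "0 \<le> s" "s \<le> r" "y s = y0"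
    and s_max: "\<And>t. 0 \<le> t \<Longrightarrow> t \<le> r \<Longrightarrow> y t = y0 \<Longrightarrow> t \<le> s"
    using compact_attains_sup[OF level[of r y0]] r y0 by auto
  have "first_zero y = ereal r"
    using r r_min by (intro first_zero_eqI) (meson linear order_trans)+
  moreover have "s < r"
    using s r y0 by (metis less_eq_real_def less_irrefl)
  moreover have "y u \<le> y0" if u: "s \<le> u" "u \<le> r" for u
  proof (rule ccontr)
    assume "\<not> y u \<le> y0"
    moreover have "continuous_on {u..r} y"
      using s u by (auto intro: continuous_on_subset[OF cont])
    ultimately obtain v where "u \<le> v" "v \<le> r" "y v = y0"
      using IVT2'[of y r y0 u] r y0 u by auto
    then have "u = s"
      using s_max[of v] s u by auto
    then show False
      using s \<open>\<not> y u \<le> y0\<close> by simp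
  qed
  ultimately show ?thesis
    using that r s by blast
qed

text \<open>
  The threshold is chosen from the driving path \<open>b\<close> before the solution, because on a given
  trajectory of the noise one \<open>K\<close> has to serve the whole family of solutions indexed by \<open>k\<close>.
\<close>

lemma positive_for_large_k:
  fixes b :: "real \<Rightarrow> real"
  assumes b: "continuous_on {0..T} b" and "\<sigma> > 0" "y0 > 0" "T \<ge> 0"
  obtains K where "K > 0"
    "\<And>k y. k \<ge> K \<Longrightarrow> solution_path a \<sigma> y0 k b y \<Longrightarrow> y 0 = y0 \<Longrightarrow> 0 < y T"
proof -
  have "uniformly_continuous_on {0..T} b"
    using b by (intro compact_uniformly_continuous) auto
  then obtain \<delta> where "\<delta> > 0" and small:
    "\<And>s r. s \<in> {0..T} \<Longrightarrow> r \<in> {0..T} \<Longrightarrow> \<bar>r - s\<bar> < \<delta> \<Longrightarrow> \<bar>b r - b s\<bar> < 2 * y0 / \<sigma>"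
    unfolding uniformly_continuous_on_def dist_real_def
    by (metis \<open>\<sigma> > 0\<close> \<open>y0 > 0\<close> divide_pos_pos mult_pos_pos zero_less_numeral)
  obtain D where "D > 0" and D: "\<And>t. t \<in> {0..T} \<Longrightarrow> \<bar>b t\<bar> \<le> D"
  proof -
    have "bounded (b ` {0..T})"
      using b by (intro compact_imp_bounded compact_continuous_image) auto
    then show ?thesis
      using that unfolding bounded_pos by auto
  qed
  \<comment> \<open>If \<open>k / y - a y\<close> is at least this \<open>C\<close>, then within time \<open>\<delta>\<close> the drift pushes the solution
    up by at least \<open>\<sigma> D\<close>, which no drop of \<open>\<sigma> / 2 * b\<close> on \<open>[0, T]\<close> can exceed. The loss of
    \<open>y0\<close> then remains unaccounted for.\<close>
  define C where "C = 2 * \<sigma> * D / \<delta>"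
  have "C > 0"
    using \<open>D > 0\<close> \<open>\<delta> > 0\<close> \<open>\<sigma> > 0\<close> by (simp add: C_def)
  define K where "K = y0 * (C + \<bar>a\<bar> * y0)"
  have "K > 0"
    using \<open>C > 0\<close> \<open>y0 > 0\<close> by (simp add: K_def add_pos_nonneg)
  moreover have "0 < y T" if k: "k \<ge> K" and sol: "solution_path a \<sigma> y0 k b y" and "y 0 = y0" for k y
  proof (rule ccontr)
    have cont: "continuous_on {0..} y"
      using sol unfolding solution_path_def by blast
    assume "\<not> 0 < y T"
    then have "y T = 0"
      using sol \<open>T \<ge> 0\<close> first_zero_gt_iff[OF sol \<open>T \<ge> 0\<close>] unfolding solution_path_def
      by (meson not_less)
    then obtain s r where sr: "0 \<le> s" "s < r" "r \<le> T" "first_zero y = ereal r" "y s = y0" "y r = 0"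
      and below: "\<And>u. s \<le> u \<Longrightarrow> u \<le> r \<Longrightarrow> y u \<le> y0"
      using last_visit_before_zero[OF cont \<open>y 0 = y0\<close> \<open>y0 > 0\<close> \<open>T \<ge> 0\<close>] by metis
    have drift: "C \<le> k / y u - a * y u" if u: "s \<le> u" "u < r" for u
    proof -
      have pos: "0 < y u"
        using first_zero_gt_iff[OF sol, of u] u sr by simp
      have "y u \<le> y0"
        using below u by simp
      have "C + \<bar>a\<bar> * y0 \<le> k / y0"
        using k \<open>y0 > 0\<close> by (simp add: K_def field_simps)
      also have "\<dots> \<le> k / y u"
        using pos \<open>y u \<le> y0\<close> k \<open>K > 0\<close> by (intro divide_left_mono) auto
      finally have "C + \<bar>a\<bar> * y0 \<le> k / y u" .
      moreover have "a * y u \<le> \<bar>a\<bar> * y0"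
        using pos \<open>y u \<le> y0\<close> by (intro mult_mono) auto
      ultimately show ?thesis
        by linarith
    qed
    \<comment> \<open>The equation is available only strictly before \<open>r\<close>, so the increment bound is carried to
      \<open>r\<close> by continuity.\<close>
    let ?g = "\<lambda>t. y t - C / 2 * (t - s) - \<sigma> / 2 * (b t - b s)"
    have "y0 \<le> ?g r"
    proof (rule continuous_ge_on_closure[where f = ?g])
      have "continuous_on {s..r} y" "continuous_on {s..r} b"
        using sr by (auto intro: continuous_on_subset[OF cont] continuous_on_subset[OF b])
      then show "continuous_on (closure {s..<r}) ?g"
        using sr by (auto intro!: continuous_intros)
      show "r \<in> closure {s..<r}"
        using sr by simp
      show "y0 \<le> ?g t" if "t \<in> {s..<r}" for t
      proof -
        have "y s + C / 2 * (t - s) + \<sigma> / 2 * (b t - b s) \<le> y t"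
          using that sr drift by (intro solution_path_increment_ge[OF sol]) auto
        then show ?thesis
          using sr by simp
      qed
    qed
    moreover have "- (\<sigma> / 2 * (b r - b s)) \<le> \<sigma> / 2 * \<bar>b r - b s\<bar>"
      using \<open>\<sigma> > 0\<close> abs_ge_minus_self[of "\<sigma> / 2 * (b r - b s)"] by (simp add: abs_mult)
    ultimately have drop: "y0 + C / 2 * (r - s) \<le> \<sigma> / 2 * \<bar>b r - b s\<bar>"
      using sr by linarith
    show False
    proof (cases "r - s < \<delta>")
      case True
      then have "\<bar>b r - b s\<bar> < 2 * y0 / \<sigma>"
        using small[of s r] sr by auto
      then have "\<sigma> / 2 * \<bar>b r - b s\<bar> < y0"
        using \<open>\<sigma> > 0\<close> by (simp add: field_simps)
      moreover have "0 \<le> C / 2 * (r - s)"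
        using \<open>C > 0\<close> sr by simp
      ultimately show False
        using drop by linarith
    next
      case False
      then have "C / 2 * \<delta> \<le> C / 2 * (r - s)"
        using \<open>C > 0\<close> by (intro mult_left_mono) auto
      moreover have "C / 2 * \<delta> = \<sigma> * D"
        using \<open>\<delta> > 0\<close> by (simp add: C_def)
      moreover have "\<sigma> / 2 * \<bar>b r - b s\<bar> \<le> \<sigma> / 2 * (2 * D)"
        using D[of r] D[of s] sr \<open>\<sigma> > 0\<close> by (intro mult_left_mono) auto
      ultimately show False
        using drop \<open>y0 > 0\<close> by simp
    qed
  qed
  ultimately show ?thesis
    using that by blast
qed

theorem theorem3:
  fixes M :: "'a measure"
    and B :: "real \<Rightarrow> 'a \<Rightarrow> real"
    and Y :: "real \<Rightarrow> real \<Rightarrow> 'a \<Rightarrow> real"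
    and H a \<sigma> y0 T :: real
  assumes "prob_space M"
    and "0 < H" and "H < 1 / 2" and "\<sigma> > 0" and "y0 > 0"
    and "fractional_brownian_motion M H B"
    and "\<And>k. k > 0 \<Longrightarrow> solution_process M a \<sigma> y0 k B (Y k)"
    and "T > 0"
  shows "((\<lambda>k. measure M {w \<in> space M. first_zero (\<lambda>t. Y k t w) > ereal T}) \<longlongrightarrow> 1) at_top"
proof -
  interpret prob_space M by fact
  define A where "A = (\<lambda>k. {w \<in> space M. first_zero (\<lambda>t. Y k t w) > ereal T})"
  have sol: "solution_path a \<sigma> y0 k (\<lambda>t. B t w) (\<lambda>t. Y k t w)" "Y k 0 w = y0"
    if "k > 0" "w \<in> space M" for k w
    using assms(7)[OF that(1)] that(2) unfolding solution_process_def by blast+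
  have A_eq: "A k = {w \<in> space M. 0 < Y k T w}" if "k > 0" for k
    using first_zero_gt_iff[OF sol(1)[OF that]] \<open>T > 0\<close> unfolding A_def by auto
  have A_sets: "A k \<in> sets M" if "k > 0" for k
  proof -
    have [measurable]: "Y k T \<in> borel_measurable M"
      using assms(7)[OF that] \<open>T > 0\<close> unfolding solution_process_def by simp
    show ?thesis
      unfolding A_eq[OF that] by measurable
  qed
  have eventually_A: "\<forall>\<^sub>F k in at_top. w \<in> A k" if w: "w \<in> space M" for w
  proof -
    have "continuous_on {0..T} (\<lambda>t. B t w)"
      using assms(6) w unfolding fractional_brownian_motion_def
      by (auto intro: continuous_on_subset)
    then obtain K where "K > 0" and K:
      "\<And>k y. k \<ge> K \<Longrightarrow> solution_path a \<sigma> y0 k (\<lambda>t. B t w) y \<Longrightarrow> y 0 = y0 \<Longrightarrow> 0 < y T"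
      using positive_for_large_k[of T "\<lambda>t. B t w" \<sigma> y0 a] assms by (metis less_imp_le)
    have "w \<in> A k" if "k \<ge> K" for k
      using K[OF that sol] w that \<open>K > 0\<close> by (auto simp: A_eq)
    then show ?thesis
      unfolding eventually_at_top_linorder by blast
  qed
  \<comment> \<open>Restricting to \<open>k > 0\<close> makes the integrand measurable for every real index, as dominated
    convergence along \<open>at_top\<close> requires; it changes nothing in the limit.\<close>
  have "((\<lambda>k. \<integral>w. (if k > 0 then indicat_real (A k) w else 0) \<partial>M) \<longlongrightarrow> (\<integral>w. 1 \<partial>M)) at_top"
  proof (rule integral_dominated_convergence_at_top[where w = "\<lambda>_. 1"])
    show "(\<lambda>w. if k > 0 then indicat_real (A k) w else 0) \<in> borel_measurable M" for k
      using A_sets by (cases "k > 0") auto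
    show "AE w in M. ((\<lambda>k. if k > 0 then indicat_real (A k) w else 0) \<longlongrightarrow> 1) at_top"
    proof (rule AE_I2)
      fix w assume "w \<in> space M"
      have "\<forall>\<^sub>F k in at_top. (if k > 0 then indicat_real (A k) w else 0) = 1"
        using eventually_A[OF \<open>w \<in> space M\<close>] eventually_gt_at_top[of 0]
        by eventually_elim simp
      then show "((\<lambda>k. if k > 0 then indicat_real (A k) w else 0) \<longlongrightarrow> 1) at_top"
        by (rule tendsto_eventually)
    qed
  qed (auto simp: indicator_def)
  moreover have "\<forall>\<^sub>F k in at_top.
      (\<integral>w. (if k > 0 then indicat_real (A k) w else 0) \<partial>M) = measure M (A k)"
    using eventually_gt_at_top[of 0] by eventually_elim (simp add: A_sets)
  ultimately show ?thesis
    by (simp add: tendsto_cong prob_space) (simp add: A_def)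
qed

end
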